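(* Let $n,m,\ell,N,K\in\mathbb{N}$, let $(\Delta,\mathcal{D},\mathbb{P})$ be a probability space with $\Delta\subseteq\mathbb{R}^\ell$, and let $A:\mathbb{R}^\ell\to\mathbb{R}^{n\times n}$, $B:\mathbb{R}^\ell\to\mathbb{R}^{n\times m}$. Let $\mathscr{X}\subseteq\mathbb{R}^n$ be a C-set, let $\mathscr{U}\subseteq\mathbb{R}^m$ be a C-polytope, and let $\mathcal{S}\subseteq\mathscr{X}$ be a C-polytope with vertices $x_1,\dots,x_N$. Fix $\beta\in(0,1)$ and let $\varepsilon:\{0,1,\dots,K\}\to[0,1]$ be a function with $\varepsilon(K)=1$ and $$\sum_{h=0}^{K-1}\binom{K}{h}\bigl(1-\varepsilon(h)\bigr)^{K-h}=\beta .$$ Assume that $\mathcal{L}_{\delta_K}\neq\emptyset$ for the $K$-multisamples $\delta_K\in\Delta^K$ under consideration (i.e. for every $\delta_K\in\Delta^K$). Then, for any choice of the tie-break maps $\Theta_p$, of the support-subsample algorithm $\Upsilon_K$, and of the probability measure $\mathbb{P}$, writing $(\boldsymbol{C}^\star_K,\boldsymbol{d}^\star_K)=\Theta_K(\delta_K)$ and $s_K=|\Upsilon_K(\delta_K)|$, $$\mathbb{P}^K\Bigl\{\delta_K\in\Delta^K \;\Big|\; V\bigl(\boldsymbol{C}^\star_K\,\cdot+\boldsymbol{d}^\star_K\bigr)>\varepsilon(s_K)\Bigr\}\le\beta .$$ That is, with confidence at least $1-\beta$, the probability (over a new independent draw $\delta\sim\mathbb{P}$) that the affine policy returns admissible vertex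 inputs certifying controlled invariance of $\mathcal{S}$ for $x^+=A(\delta)x+B(\delta)u$ is at least $1-\varepsilon(s_K)$.
   Context: A C-set is a convex bounded set containing the origin in its interior; a C-polytope is a polyhedral C-set. $\mathbb{P}^K$ is the $K$-fold product measure on $\Delta^K$; a $K$-multisample $\delta_K=(\delta^{(1)},\dots,\delta^{(K)})\in\Delta^K$ consists of $K$ i.i.d. draws from $\mathbb{P}$. Let $\mathcal{M}$ be the set of pairs $(\boldsymbol{C},\boldsymbol{d})$ with $\boldsymbol{C}=\mathrm{col}(C_1,\dots,C_N)$, $C_i\in\mathbb{R}^{m\times\ell}$, and $\boldsymbol{d}=\mathrm{col}(d_1,\dots,d_N)$, $d_i\in\mathbb{R}^m$; such a pair defines the affine policy $\delta\mapsto\boldsymbol{C}\delta+\boldsymbol{d}=\mathrm{col}(C_1\delta+d_1,\dots,C_N\delta+d_N)$. For $\delta\in\Delta$ define $\mathcal{U}_\delta=\{\boldsymbol{u}=\mathrm{col}(u_1,\dots,u_N)\in\mathscr{U}^N : A(\delta)x_i+B(\delta)u_i\in\mathcal{S}\ \forall i\}$ and $\mathcal{L}_\delta=\{(\boldsymbol{C},\boldsymbol{d})\in\mathcal{M} : C_i\delta+d_i\in\mathscr{U},\ A(\delta)x_i+B(\delta)(C_i\delta+d_i)\in\mathcal{S}\ \forall i=1,\dots,N\}$, and for a multisample $\mathcal{L}_{\delta_K}=\bigcap_{j=1}^K\mathcal{L}_{\delta^{(j)}}$. For each $p\in\mathbb{N}$, $\Theta_p:\Delta^p\to\mathcal{M}$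 is a single-valued map (a tie-break rule) assigning to each $p$-multisample with nonempty $\mathcal{L}$ an element of that set. A support subsample of $\delta_K$ is a tuple $(\delta^{(i_1)},\dots,\delta^{(i_p)})$ with $i_1<\dots<i_p$ such that $\Theta_p(\delta^{(i_1)},\dots,\delta^{(i_p)})=\Theta_K(\delta_K)$; $\Upsilon_K$ is any map returning, for each $\delta_K$, an index set $\{i_1,\dots,i_p\}$ of a support subsample. For $(\boldsymbol{C},\boldsymbol{d})\in\mathcal{M}$, the violation probability is $V(\boldsymbol{C}\,\cdot+\boldsymbol{d})=\mathbb{P}\{\delta\in\Delta : \boldsymbol{C}\delta+\boldsymbol{d}\notin\mathcal{U}_\delta\}$.
   Formalization: The tie-break maps Θ_p are assumed measurable with respect to the product σ-algebras (and A, B measurable); without measurability of Θ_p the event whose probability is bounded may fail to be measurable, so its probability is undefined. *)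

theory Defs
  imports "HOL-Probability.Probability"
begin

definition C_set :: "'a::euclidean_space set \<Rightarrow> bool" where
  "C_set S \<longleftrightarrow> convex S \<and> bounded S \<and> 0 \<in> interior S"

definition C_polytope :: "'a::euclidean_space set \<Rightarrow> bool" where
  "C_polytope S \<longleftrightarrow> C_set S \<and> polyhedron S"

text \<open>Vertex inputs u = col(u_1,...,u_N), indexed by the finite vertex index type 'k.
  An element (C,d) of the parameter set M: C $ i is the m x l matrix C_i, d $ i the vector d_i.\<close>

definition Ucal ::
  "('l \<Rightarrow> real^'n^'n) \<Rightarrow> ('l \<Rightarrow> real^'m^'n) \<Rightarrow> (real^'m) set \<Rightarrow> (real^'n) set
   \<Rightarrow> ('k \<Rightarrow> real^'n) \<Rightarrow> 'l \<Rightarrow> (real^'m^'k) set" where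
  "Ucal A B U S x \<delta> = {u. \<forall>i. u $ i \<in> U \<and> A \<delta> *v x i + B \<delta> *v (u $ i) \<in> S}"

definition policy :: "(real^'l^'m^'k) \<times> (real^'m^'k) \<Rightarrow> real^'l \<Rightarrow> real^'m^'k" where
  "policy \<theta> \<delta> = (\<chi> i. (fst \<theta>) $ i *v \<delta> + (snd \<theta>) $ i)"

definition Lcal ::
  "(real^'l \<Rightarrow> real^'n^'n) \<Rightarrow> (real^'l \<Rightarrow> real^'m^'n) \<Rightarrow> (real^'m) set \<Rightarrow> (real^'n) set
   \<Rightarrow> ('k \<Rightarrow> real^'n) \<Rightarrow> real^'l \<Rightarrow> ((real^'l^'m^'k) \<times> (real^'m^'k)) set" where
  "Lcal A B U S x \<delta> = {(C, d). \<forall>i. C $ i *v \<delta> + d $ i \<in> U \<and>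
       A \<delta> *v x i + B \<delta> *v (C $ i *v \<delta> + d $ i) \<in> S}"

definition Lmulti ::
  "(real^'l \<Rightarrow> real^'n^'n) \<Rightarrow> (real^'l \<Rightarrow> real^'m^'n) \<Rightarrow> (real^'m) set \<Rightarrow> (real^'n) set
   \<Rightarrow> ('k \<Rightarrow> real^'n) \<Rightarrow> nat \<Rightarrow> (nat \<Rightarrow> real^'l) \<Rightarrow> ((real^'l^'m^'k) \<times> (real^'m^'k)) set" where
  "Lmulti A B U S x p \<delta>s = (\<Inter>j\<in>{..<p}. Lcal A B U S x (\<delta>s j))"

definition Viol ::
  "(real^'l) measure \<Rightarrow> (real^'l \<Rightarrow> real^'n^'n) \<Rightarrow> (real^'l \<Rightarrow> real^'m^'n) \<Rightarrow> (real^'m) set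
   \<Rightarrow> (real^'n) set \<Rightarrow> ('k \<Rightarrow> real^'n) \<Rightarrow> (real^'l^'m^'k) \<times> (real^'m^'k) \<Rightarrow> real" where
  "Viol P A B U S x \<theta> = measure P {\<delta> \<in> space P. policy \<theta> \<delta> \<notin> Ucal A B U S x \<delta>}"

definition subsample :: "(nat \<Rightarrow> 'a) \<Rightarrow> nat set \<Rightarrow> nat \<Rightarrow> 'a" where
  "subsample \<delta>s I = (\<lambda>j\<in>{..<card I}. \<delta>s (sorted_list_of_set I ! j))"

end

theory Submission
  imports Defs
begin

text \<open>
  On a bad multisample with support index set I, the decision is a function of the samples
  indexed by I and none of the remaining K - |I| samples falls into its violation set, whose
  probability exceeds \<epsilon>(|I|). Conditionally on the samples in I this has probability at most
  (1 - \<epsilon>(|I|))^(K - |I|), and the union bound over all I gives \<beta>; index sets with |I| = K do not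
  contribute because \<epsilon>(K) = 1.

  The violation probability need not be a measurable function of the multisample. This is
  circumvented by conditioning on the larger event that the conditional probability of
  ``the decision is determined by I'' is at most (1 - \<epsilon>(|I|))^(K - |I|), which is measurable.
\<close>

text \<open>Tonelli: \<open>G\<close> consists of the points of \<open>F\<close> whose
  \<open>J\<close>-section has measure at most \<open>c\<close>. Each \<open>J\<close>-section of
  \<open>G\<close> then has measure at most \<open>c\<close>, and integrating over the probability
  measure on the \<open>I\<close>-coordinates keeps this bound. \<open>G\<close> serves as a
  measurable cover for subsets of \<open>F\<close> that need not be measurable themselves.\<close>

lemma (in product_sigma_finite) emeasure_PiM_sections_le:
  assumes fin: "finite I" "finite J" and disj: "I \<inter> J = {}"
    and F: "F \<in> sets (PiM (I \<union> J) M)"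
    and I_prob: "prob_space (PiM I M)"
  obtains G where "G \<in> sets (PiM (I \<union> J) M)" "emeasure (PiM (I \<union> J) M) G \<le> c"
    "\<And>\<omega>. \<omega> \<in> F \<Longrightarrow>
       emeasure (PiM J M) {b \<in> space (PiM J M). merge I J (restrict \<omega> I, b) \<in> F} \<le> c \<Longrightarrow> \<omega> \<in> G"
proof -
  interpret J: sigma_finite_measure "PiM J M"
    using fin(2) by (rule sigma_finite)
  define m where "m a = emeasure (PiM J M) {b \<in> space (PiM J M). merge I J (a, b) \<in> F}" for a
  define F' where "F' = merge I J -` F \<inter> space (PiM I M \<Otimes>\<^sub>M PiM J M)"
  have F': "F' \<in> sets (PiM I M \<Otimes>\<^sub>M PiM J M)"
    unfolding F'_def using F by (intro measurable_sets[OF measurable_merge]) auto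
  have sect: "Pair a -` F' = {b \<in> space (PiM J M). merge I J (a, b) \<in> F}"
    if "a \<in> space (PiM I M)" for a
    using that by (auto simp: F'_def space_pair_measure)
  \<comment> \<open>Measurability of section measures is available on the binary product, hence the
    detour through \<open>F'\<close>; its sections are those in \<open>m\<close> only for
    \<open>a\<close> in the space, which suffices for the congruence rule.\<close>
  have [measurable]: "m \<in> borel_measurable (PiM I M)"
    using J.measurable_emeasure_Pair[OF F']
    by (rule measurable_cong[THEN iffD1, rotated]) (simp add: m_def sect)
  have [measurable]: "F \<in> sets (PiM (I \<union> J) M)" by fact
  have [measurable]: "(\<lambda>\<omega>. restrict \<omega> I) \<in> measurable (PiM (I \<union> J) M) (PiM I M)"
    by (rule measurable_restrict_subset) auto
  define G where "G = {\<omega> \<in> space (PiM (I \<union> J) M). \<omega> \<in> F \<and> m (restrict \<omega> I) \<le> c}"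
  have G[measurable]: "G \<in> sets (PiM (I \<union> J) M)"
    unfolding G_def by measurable
  define G' where "G' = merge I J -` G \<inter> space (PiM I M \<Otimes>\<^sub>M PiM J M)"
  have G': "G' \<in> sets (PiM I M \<Otimes>\<^sub>M PiM J M)"
    unfolding G'_def using G by (intro measurable_sets[OF measurable_merge]) auto
  have "emeasure (PiM (I \<union> J) M) G = emeasure (PiM I M \<Otimes>\<^sub>M PiM J M) G'"
    unfolding G'_def
    by (subst distr_merge[OF disj fin, symmetric], subst emeasure_distr) (auto intro: G)
  also have "\<dots> = (\<integral>\<^sup>+a. emeasure (PiM J M) (Pair a -` G') \<partial>PiM I M)"
    by (rule J.emeasure_pair_measure_alt[OF G'])
  also have "\<dots> \<le> (\<integral>\<^sup>+a. c \<partial>PiM I M)"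
  proof (rule nn_integral_mono)
    fix a assume a: "a \<in> space (PiM I M)"
    have restr: "restrict (merge I J (a, b)) I = a" for b
      using a disj by (simp add: space_PiM PiE_restrict)
    show "emeasure (PiM J M) (Pair a -` G') \<le> c"
    \<comment> \<open>By \<open>restr\<close>, the condition defining \<open>G\<close> depends on
      \<open>a\<close> alone along a section, so the section of \<open>G\<close> either lies in that
      of \<open>F\<close> or is empty.\<close>
    proof (cases "m a \<le> c")
      case True
      have "Pair a -` G' \<subseteq> Pair a -` F'"
        by (auto simp: G'_def F'_def G_def)
      then have "emeasure (PiM J M) (Pair a -` G') \<le> m a"
        unfolding m_def sect[OF a, symmetric]
        by (rule emeasure_mono) (rule sets_Pair1[OF F'])
      then show ?thesis using True by order
    next
      case False
      then have "Pair a -` G' = {}"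
        by (auto simp: G'_def G_def restr)
      then show ?thesis by simp
    qed
  qed
  also have "\<dots> = c"
    using prob_space.emeasure_space_1[OF I_prob] by simp
  finally have "emeasure (PiM (I \<union> J) M) G \<le> c" .
  moreover have "\<omega> \<in> G"
    if "\<omega> \<in> F" "emeasure (PiM J M) {b \<in> space (PiM J M). merge I J (restrict \<omega> I, b) \<in> F} \<le> c"
    for \<omega>
    using that sets.sets_into_space[OF F] by (auto simp: G_def m_def)
  ultimately show thesis using G that by blast
qed

lemma nth_sorted_list_of_set_in:
  assumes "finite I" "j < card I"
  shows "sorted_list_of_set I ! j \<in> I"
  using assms by (metis nth_mem set_sorted_list_of_set length_sorted_list_of_set)

lemma measurable_subsample:
  assumes "I \<subseteq> {..<K}"
  shows "(\<lambda>\<delta>s. subsample \<delta>s I) \<in> measurable (PiM {..<K} (\<lambda>_. P)) (PiM {..<card I} (\<lambda>_. P))"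
  unfolding subsample_def
  using nth_sorted_list_of_set_in[OF finite_subset[OF assms]] assms
  by (intro measurable_restrict measurable_component_singleton) auto

text \<open>A subsample reads only coordinates in \<open>I\<close>. Hence a decision computed from
  it stays constant while the \<open>J\<close>-coordinates vary.\<close>

lemma subsample_merge:
  assumes "finite I"
  shows "subsample (merge I J (a, b)) I = subsample a I"
  unfolding subsample_def using nth_sorted_list_of_set_in[OF assms]
  by (intro restrict_ext) (simp add: merge_def)

lemma subsample_restrict:
  assumes "finite I"
  shows "subsample (restrict a I) I = subsample a I"
  unfolding subsample_def using nth_sorted_list_of_set_in[OF assms]
  by (intro restrict_ext) simp

text \<open>With the \<open>I\<close>-coordinates frozen, all multisamples determined by
  \<open>I\<close> share one decision, and by consistency their remaining coordinates all avoid its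
  violation set. Independence turns this into a power of the complementary probability. A measurable
  superset \<open>G\<close> is produced because \<open>V\<close> is an arbitrary set-valued
  map.\<close>

lemma support_set_outer_bound:
  fixes \<Theta> :: "nat \<Rightarrow> (nat \<Rightarrow> 'a) \<Rightarrow> 'b::{second_countable_topology, t2_space}"
    and V :: "'b \<Rightarrow> 'a set"
  assumes P: "prob_space P"
    and \<Theta>_meas: "\<And>p. \<Theta> p \<in> borel_measurable (PiM {..<p} (\<lambda>_. P))"
    and consistent: "\<And>\<delta>s j. \<delta>s \<in> space (PiM {..<K} (\<lambda>_. P)) \<Longrightarrow> j < K \<Longrightarrow> \<delta>s j \<notin> V (\<Theta> K \<delta>s)"
    and I: "I \<subseteq> {..<K}" and e: "0 \<le> e" "e \<le> 1"
  obtains G where "G \<in> sets (PiM {..<K} (\<lambda>_. P))"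
    "measure (PiM {..<K} (\<lambda>_. P)) G \<le> (1 - e) ^ (K - card I)"
    "{\<delta>s \<in> space (PiM {..<K} (\<lambda>_. P)). \<Theta> (card I) (subsample \<delta>s I) = \<Theta> K \<delta>s \<and>
        e < measure P (V (\<Theta> K \<delta>s))} \<subseteq> G"
proof -
  interpret P: prob_space P by fact
  interpret product_sigma_finite "\<lambda>_::nat. P" by unfold_locales
  define J where "J = {..<K} - I"
  have finI: "finite I" and finJ: "finite J" and disj: "I \<inter> J = {}" and un: "I \<union> J = {..<K}"
    using I by (auto simp: J_def intro: finite_subset)
  have cardJ: "card J = K - card I"
    using I by (simp add: J_def card_Diff_subset finI)
  define F where "F = {\<delta>s \<in> space (PiM {..<K} (\<lambda>_. P)). \<Theta> (card I) (subsample \<delta>s I) = \<Theta> K \<delta>s}"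
  have [measurable]: "(\<lambda>\<delta>s. \<Theta> (card I) (subsample \<delta>s I)) \<in> borel_measurable (PiM {..<K} (\<lambda>_. P))"
    by (rule measurable_compose[OF measurable_subsample[OF I] \<Theta>_meas])
  have [measurable]: "\<Theta> K \<in> borel_measurable (PiM {..<K} (\<lambda>_. P))"
    by (rule \<Theta>_meas)
  \<comment> \<open>The set where two measurable maps agree is measurable because the decision space
    is second countable and Hausdorff; this is the reason for the sort of \<open>'b\<close>.\<close>
  have F: "F \<in> sets (PiM (I \<union> J) (\<lambda>_. P))"
    unfolding F_def un by (rule measurable_equality_set) measurable
  define c where "c = (1 - e) ^ (K - card I)"
  have c0: "0 \<le> c" using e by (simp add: c_def)
  obtain G where G: "G \<in> sets (PiM (I \<union> J) (\<lambda>_. P))" "emeasure (PiM (I \<union> J) (\<lambda>_. P)) G \<le> ennreal c"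
    and in_G: "\<And>\<omega>. \<omega> \<in> F \<Longrightarrow> emeasure (PiM J (\<lambda>_. P))
        {b \<in> space (PiM J (\<lambda>_. P)). merge I J (restrict \<omega> I, b) \<in> F} \<le> ennreal c \<Longrightarrow> \<omega> \<in> G"
    by (rule emeasure_PiM_sections_le[OF finI finJ disj F prob_space_PiM[OF P], of "ennreal c"]) blast
  have "\<delta>s \<in> G" if \<delta>s: "\<delta>s \<in> F" and viol: "e < measure P (V (\<Theta> K \<delta>s))" for \<delta>s
  proof (rule in_G[OF \<delta>s])
    define \<theta> where "\<theta> = \<Theta> K \<delta>s"
    \<comment> \<open>\<open>measure\<close> is 0 on non-measurable sets, so exceeding
      \<open>e \<ge> 0\<close> forces measurability.\<close>
    have V: "V \<theta> \<in> sets P"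
      using viol e measure_notin_sets[of "V \<theta>" P] by (auto simp: \<theta>_def)
    have "b \<in> PiE J (\<lambda>_. space P - V \<theta>)"
      if b: "b \<in> space (PiM J (\<lambda>_. P))" and mF: "merge I J (restrict \<delta>s I, b) \<in> F" for b
    proof -
      \<comment> \<open>Both \<open>\<delta>s\<close> and the merged point lie in \<open>F\<close>
        and have the same \<open>I\<close>-subsample, so both full decisions equal the decision on
        that subsample.\<close>
      have "\<Theta> K (merge I J (restrict \<delta>s I, b)) = \<theta>"
        using mF \<delta>s by (simp add: F_def \<theta>_def subsample_merge subsample_restrict finI)
      moreover have "merge I J (restrict \<delta>s I, b) j = b j" if "j \<in> J" for j
        using that disj by (auto simp: merge_def)
      ultimately have "b j \<notin> V \<theta>" if "j \<in> J" for j
        using consistent[of "merge I J (restrict \<delta>s I, b)" j] mF that by (auto simp: F_def J_def)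
      then show ?thesis using b by (auto simp: space_PiM PiE_iff)
    qed
    then have "emeasure (PiM J (\<lambda>_. P)) {b \<in> space (PiM J (\<lambda>_. P)). merge I J (restrict \<delta>s I, b) \<in> F}
        \<le> emeasure (PiM J (\<lambda>_. P)) (PiE J (\<lambda>_. space P - V \<theta>))"
      using V finJ by (intro emeasure_mono) (auto intro!: sets_PiM_I_finite)
    also have "\<dots> = (\<Prod>j\<in>J. emeasure P (space P - V \<theta>))"
      using V finJ by (intro emeasure_PiM) auto
    also have "\<dots> = ennreal ((1 - measure P (V \<theta>)) ^ (K - card I))"
      using V by (simp add: P.emeasure_eq_measure P.prob_compl cardJ ennreal_power)
    also have "\<dots> \<le> ennreal c"
      unfolding c_def using viol e by (intro ennreal_leI power_mono) (auto simp: \<theta>_def)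
    finally show "emeasure (PiM J (\<lambda>_. P))
        {b \<in> space (PiM J (\<lambda>_. P)). merge I J (restrict \<delta>s I, b) \<in> F} \<le> ennreal c" .
  qed
  moreover have "measure (PiM {..<K} (\<lambda>_. P)) G \<le> c"
    using G(2) c0 unfolding un measure_def by (simp add: enn2real_leI)
  ultimately show thesis
    using that[of G] G(1) unfolding un by (auto simp: F_def c_def)
qed

text \<open>Every bad multisample lies in \<open>D I\<close> for
  \<open>I = \<Upsilon> \<delta>s\<close>. Taking the union over all candidate index sets makes the
  bound independent of how \<open>\<Upsilon>\<close> selects one, and no measurability of
  \<open>\<Upsilon>\<close> is required.\<close>

lemma scenario_compression_bound:
  fixes \<Theta> :: "nat \<Rightarrow> (nat \<Rightarrow> 'a) \<Rightarrow> 'b::{second_countable_topology, t2_space}"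
    and V :: "'b \<Rightarrow> 'a set" and \<epsilon> :: "nat \<Rightarrow> real"
  assumes P: "prob_space P"
    and \<Theta>_meas: "\<And>p. \<Theta> p \<in> borel_measurable (PiM {..<p} (\<lambda>_. P))"
    and consistent: "\<And>\<delta>s j. \<delta>s \<in> space (PiM {..<K} (\<lambda>_. P)) \<Longrightarrow> j < K \<Longrightarrow> \<delta>s j \<notin> V (\<Theta> K \<delta>s)"
    and support: "\<And>\<delta>s. \<delta>s \<in> space (PiM {..<K} (\<lambda>_. P)) \<Longrightarrow>
        \<Upsilon> \<delta>s \<subseteq> {..<K} \<and> \<Theta> (card (\<Upsilon> \<delta>s)) (subsample \<delta>s (\<Upsilon> \<delta>s)) = \<Theta> K \<delta>s"
    and \<epsilon>_range: "\<And>h. h \<le> K \<Longrightarrow> 0 \<le> \<epsilon> h \<and> \<epsilon> h \<le> 1" and \<epsilon>_K: "\<epsilon> K = 1"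
  shows "measure (PiM {..<K} (\<lambda>_. P))
           {\<delta>s \<in> space (PiM {..<K} (\<lambda>_. P)). \<epsilon> (card (\<Upsilon> \<delta>s)) < measure P (V (\<Theta> K \<delta>s))}
         \<le> (\<Sum>h<K. real (K choose h) * (1 - \<epsilon> h) ^ (K - h))"
proof -
  let ?M = "PiM {..<K} (\<lambda>_. P)"
  interpret P: prob_space P by fact
  interpret M: prob_space ?M by (rule prob_space_PiM) (rule P)
  define \<I> where "\<I> = {I. I \<subseteq> {..<K} \<and> card I < K}"
  define D where "D I = {\<delta>s \<in> space ?M. \<Theta> (card I) (subsample \<delta>s I) = \<Theta> K \<delta>s \<and>
      \<epsilon> (card I) < measure P (V (\<Theta> K \<delta>s))}" for I
  have fin: "finite \<I>" by (auto simp: \<I>_def)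
  have "\<exists>G. G \<in> sets ?M \<and> measure ?M G \<le> (1 - \<epsilon> (card I)) ^ (K - card I) \<and> D I \<subseteq> G"
    if "I \<in> \<I>" for I
  proof -
    have I: "I \<subseteq> {..<K}" and e: "0 \<le> \<epsilon> (card I)" "\<epsilon> (card I) \<le> 1"
      using that \<epsilon>_range[of "card I"] by (auto simp: \<I>_def)
    show ?thesis
      unfolding D_def by (rule support_set_outer_bound[OF P \<Theta>_meas consistent I e]) blast+
  qed
  then obtain G where G: "\<And>I. I \<in> \<I> \<Longrightarrow> G I \<in> sets ?M"
      "\<And>I. I \<in> \<I> \<Longrightarrow> measure ?M (G I) \<le> (1 - \<epsilon> (card I)) ^ (K - card I)"
      "\<And>I. I \<in> \<I> \<Longrightarrow> D I \<subseteq> G I"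
    by metis
  have "{\<delta>s \<in> space ?M. \<epsilon> (card (\<Upsilon> \<delta>s)) < measure P (V (\<Theta> K \<delta>s))} \<subseteq> (\<Union>I\<in>\<I>. G I)"
  proof safe
    fix \<delta>s assume \<delta>s: "\<delta>s \<in> space ?M" and viol: "\<epsilon> (card (\<Upsilon> \<delta>s)) < measure P (V (\<Theta> K \<delta>s))"
    have "card (\<Upsilon> \<delta>s) \<le> K"
      using support[OF \<delta>s] card_mono[of "{..<K}" "\<Upsilon> \<delta>s"] by simp
    moreover have "card (\<Upsilon> \<delta>s) \<noteq> K"
      using viol \<epsilon>_K P.prob_le_1[of "V (\<Theta> K \<delta>s)"] by (metis not_le)
    ultimately have "\<Upsilon> \<delta>s \<in> \<I>"
      using support[OF \<delta>s] by (auto simp: \<I>_def)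
    moreover have "\<delta>s \<in> D (\<Upsilon> \<delta>s)"
      using \<delta>s viol support[OF \<delta>s] by (simp add: D_def)
    ultimately show "\<delta>s \<in> (\<Union>I\<in>\<I>. G I)" using G(3) by blast
  qed
  \<comment> \<open>Monotonicity asks for measurability of the larger set only, so the bad event
    itself may be non-measurable.\<close>
  then have "measure ?M {\<delta>s \<in> space ?M. \<epsilon> (card (\<Upsilon> \<delta>s)) < measure P (V (\<Theta> K \<delta>s))}
      \<le> measure ?M (\<Union>I\<in>\<I>. G I)"
    using fin G(1) by (intro M.finite_measure_mono) auto
  also have "\<dots> \<le> (\<Sum>I\<in>\<I>. measure ?M (G I))"
    using fin G(1) by (intro M.finite_measure_subadditive_finite) auto
  also have "\<dots> \<le> (\<Sum>I\<in>\<I>. (1 - \<epsilon> (card I)) ^ (K - card I))"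
    by (intro sum_mono G(2))
  \<comment> \<open>The summand depends only on the cardinality of \<open>I\<close>; grouping by it
    produces the binomial coefficients.\<close>
  also have "\<dots> = (\<Sum>h<K. \<Sum>I\<in>{I \<in> \<I>. card I = h}. (1 - \<epsilon> (card I)) ^ (K - card I))"
    using fin by (intro sum.group[symmetric]) (auto simp: \<I>_def)
  also have "\<dots> = (\<Sum>h<K. real (K choose h) * (1 - \<epsilon> h) ^ (K - h))"
  proof (rule sum.cong[OF refl])
    fix h assume "h \<in> {..<K}"
    then have "{I \<in> \<I>. card I = h} = {I. I \<subseteq> {..<K} \<and> card I = h}"
      by (auto simp: \<I>_def)
    then show "(\<Sum>I\<in>{I \<in> \<I>. card I = h}. (1 - \<epsilon> (card I)) ^ (K - card I))
        = real (K choose h) * (1 - \<epsilon> h) ^ (K - h)"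
      using n_subsets[of "{..<K}" h] by simp
  qed
  finally show ?thesis .
qed

text \<open>Links the violation event to the scenario constraints: parameters chosen in
  \<open>Lmulti\<close> are never violated at the samples they were computed from.\<close>

lemma policy_in_Ucal_iff: "policy \<theta> \<delta> \<in> Ucal A B U S x \<delta> \<longleftrightarrow> \<theta> \<in> Lcal A B U S x \<delta>"
  by (cases \<theta>) (simp add: policy_def Ucal_def Lcal_def)

theorem theorem1:
  fixes P :: "(real^'l) measure"
    and A :: "real^'l \<Rightarrow> real^'n^'n" and B :: "real^'l \<Rightarrow> real^'m^'n"
    and X :: "(real^'n) set" and U :: "(real^'m) set" and S :: "(real^'n) set"
    and x :: "'k::finite \<Rightarrow> real^'n"
    and K :: nat and \<beta> :: real and \<epsilon> :: "nat \<Rightarrow> real"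
    and \<Theta> :: "nat \<Rightarrow> (nat \<Rightarrow> real^'l) \<Rightarrow> (real^'l^'m^'k) \<times> (real^'m^'k)"
    and \<Upsilon> :: "(nat \<Rightarrow> real^'l) \<Rightarrow> nat set"
  assumes P: "prob_space P"
    and A_meas: "A \<in> borel_measurable P" and B_meas: "B \<in> borel_measurable P"
    and X: "C_set X" and U: "C_polytope U" and S: "C_polytope S" and SX: "S \<subseteq> X"
    and vert: "{v. v extreme_point_of S} = range x" and x_inj: "inj x"
    and \<beta>: "0 < \<beta>" "\<beta> < 1"
    and \<epsilon>_range: "\<forall>h\<le>K. 0 \<le> \<epsilon> h \<and> \<epsilon> h \<le> 1"
    and \<epsilon>_K: "\<epsilon> K = 1"
    and \<epsilon>_sum: "(\<Sum>h<K. real (K choose h) * (1 - \<epsilon> h) ^ (K - h)) = \<beta>"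
    and feasible: "\<forall>\<delta>s\<in>PiE {..<K} (\<lambda>_. space P). Lmulti A B U S x K \<delta>s \<noteq> {}"
    and tiebreak: "\<forall>p. \<forall>\<delta>s\<in>PiE {..<p} (\<lambda>_. space P).
                     Lmulti A B U S x p \<delta>s \<noteq> {} \<longrightarrow> \<Theta> p \<delta>s \<in> Lmulti A B U S x p \<delta>s"
    and \<Theta>_meas: "\<forall>p. \<Theta> p \<in> borel_measurable (PiM {..<p} (\<lambda>_. P))"
    and support: "\<forall>\<delta>s\<in>PiE {..<K} (\<lambda>_. space P).
                    \<Upsilon> \<delta>s \<subseteq> {..<K} \<and>
                    \<Theta> (card (\<Upsilon> \<delta>s)) (subsample \<delta>s (\<Upsilon> \<delta>s)) = \<Theta> K \<delta>s"
  shows "measure (PiM {..<K} (\<lambda>_. P))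
           {\<delta>s \<in> space (PiM {..<K} (\<lambda>_. P)).
              Viol P A B U S x (\<Theta> K \<delta>s) > \<epsilon> (card (\<Upsilon> \<delta>s))} \<le> \<beta>"

proof -
  define V where "V \<theta> = {\<delta> \<in> space P. policy \<theta> \<delta> \<notin> Ucal A B U S x \<delta>}" for \<theta>
  have "\<delta>s j \<notin> V (\<Theta> K \<delta>s)" if \<delta>s: "\<delta>s \<in> space (PiM {..<K} (\<lambda>_. P))" and j: "j < K" for \<delta>s j
  proof -
    \<comment> \<open>Feasibility activates the tie-break rule. Membership in the intersection over
      all samples is exactly the consistency required by the abstract bound.\<close>
    have "\<Theta> K \<delta>s \<in> Lmulti A B U S x K \<delta>s"
      using \<delta>s feasible tiebreak by (simp add: space_PiM)
    then show ?thesis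
      using j by (auto simp: V_def Lmulti_def policy_in_Ucal_iff)
  qed
  then show ?thesis
    using scenario_compression_bound[of P \<Theta> K V \<Upsilon> \<epsilon>] P \<Theta>_meas support \<epsilon>_range \<epsilon>_K
    by (simp add: Viol_def V_def \<epsilon>_sum space_PiM)
qed

end
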